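(* Let $\mathcal{D}_{\mathrm{cal}}=\{(\boldsymbol{x}_i,y_i)\}_{i=1}^n$ be a calibration set, let $(\boldsymbol{x}_{n+1},y_{n+1})$ be exchangeable with it, and let $\tilde{\boldsymbol{x}}_{n+1}\in\mathcal{B}(\boldsymbol{x}_{n+1})$ be a (possibly random, adversarially chosen) perturbed test input. Let $0<\eta<\alpha<1$. Let $\hat{s}$ be the smooth score and $\underline{s}_{\mathrm{cdf}}$ its CDF-based lower bound over the threat model $\mathcal{B}$ (both defined in the context). Suppose that $\underline{s}_{\mathrm{cdf}+}(\boldsymbol{x}_i,y_i)$, $i=1,\dots,n$, are real random variables such that for each $i$ the inequality $\underline{s}_{\mathrm{cdf}+}(\boldsymbol{x}_i,y_i)\le\underline{s}_{\mathrm{cdf}}(\boldsymbol{x}_i,y_i)$ holds with probability at least $1-\eta/(2|\mathcal{D}_{\mathrm{cal}}|)$, and that $\hat{s}_+(\tilde{\boldsymbol{x}}_{n+1},y)$, $y\in\mathcal{Y}$, are real random variables such that $\hat{s}_+(\tilde{\boldsymbol{x}}_{n+1},y_{n+1})\ge\hat{s}(\tilde{\boldsymbol{x}}_{n+1},y_{n+1})$ holds with probability at least $1-\eta/(2|\mathcal{Y}|)$. Define $$\underline{q}_{\alpha+}=\mathrm{Quant}\left(\alpha-\eta;\{\underline{s}_{\mathrm{cdf}+}(\boldsymbol{x}_i,y_i)\}_{i=1}^n\right),\qquad\overline{\mathcal{C}}_{\alpha+}(\tilde{\boldsymbol{x}}_{n+1})=\{y\in\mathcal{Y}:\hat{s}_+(\tilde{\boldsymbol{x}}_{n+1},y)\ge\underline{q}_{\alpha+}\}.$$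 Then $$\Pr\left[y_{n+1}\in\overline{\mathcal{C}}_{\alpha+}(\tilde{\boldsymbol{x}}_{n+1})\right]\ge1-\alpha.$$
   Context: $\mathcal{X}$ is the input space, $\mathcal{Y}$ a finite label set, $|\mathcal{D}_{\mathrm{cal}}|=n$. All functions and random elements are assumed measurable as needed. Probabilities are over all randomness (data and Monte-Carlo sampling). "$(\boldsymbol{x}_{n+1},y_{n+1})$ exchangeable with $\mathcal{D}_{\mathrm{cal}}$" means that $(\boldsymbol{x}_1,y_1),\dots,(\boldsymbol{x}_{n+1},y_{n+1})$ are exchangeable. A threat model is a map $\mathcal{B}$ assigning to each clean input $\boldsymbol{x}\in\mathcal{X}$ the set $\mathcal{B}(\boldsymbol{x})\subseteq\mathcal{X}$ of allowed perturbed inputs. Smoothing: $s:\mathcal{X}\times\mathcal{Y}\to[a,b]$ is a bounded base score; $\xi$ is a smoothing scheme, i.e. a random map sending each $\boldsymbol{x}\in\mathcal{X}$ to a random point $\xi(\boldsymbol{x})\in\mathcal{X}$ (e.g. $\boldsymbol{x}+\boldsymbol{\delta}$ with $\boldsymbol{\delta}\sim\mathcal{N}(\boldsymbol{0},\sigma^2\boldsymbol{I})$). The smooth score is $\hat{s}(\boldsymbol{x},y)=\mathbb{E}[s(\xi(\boldsymbol{x}),y)]$. CDF-based lower bound: fix $a=b_1<b_2\le\dots\le b_{m-1}<b_m=b$. For $(\boldsymbol{x},y)$ let $p_j=\Pr[s(\xi(\boldsymbol{x}),y)\le b_j]$ (probability over $\xi$). Then $\underline{s}_{\mathrm{cdf}}(\boldsymbol{x},y)$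 is the infimum of $\mathbb{E}[h(\xi(\tilde{\boldsymbol{x}}),y)]$ over all $\tilde{\boldsymbol{x}}\in\mathcal{B}(\boldsymbol{x})$ and all measurable $h:\mathcal{X}\times\mathcal{Y}\to[a,b]$ satisfying $\Pr[h(\xi(\boldsymbol{x}),y)\le b_j]=p_j$ for all $j$. In particular it is a deterministic function of $(\boldsymbol{x},y)$. Quantile convention: for a finite family $A$ of $n$ real numbers and $\tau\in(0,1)$, $\mathrm{Quant}(\tau;A)$ is the $\lfloor\tau(n+1)\rfloor$-th smallest element of $A$ (counted with multiplicity), and $-\infty$ if $\lfloor\tau(n+1)\rfloor=0$. *)

theory Defs
  imports "HOL-Probability.Probability" "HOL-Combinatorics.Permutations"
begin

definition exchangeable ::
  "'w measure \<Rightarrow> 'z measure \<Rightarrow> 'i set \<Rightarrow> ('i \<Rightarrow> 'w \<Rightarrow> 'z) \<Rightarrow> bool" where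
  "exchangeable M S I Z \<longleftrightarrow>
     (\<forall>i\<in>I. Z i \<in> measurable M S) \<and>
     (\<forall>\<pi>. \<pi> permutes I \<longrightarrow>
        distr M (\<Pi>\<^sub>M i\<in>I. S) (\<lambda>\<omega>. \<lambda>i\<in>I. Z (\<pi> i) \<omega>) =
        distr M (\<Pi>\<^sub>M i\<in>I. S) (\<lambda>\<omega>. \<lambda>i\<in>I. Z i \<omega>))"

definition bounded_score ::
  "'x measure \<Rightarrow> 'y set \<Rightarrow> real \<Rightarrow> real \<Rightarrow> ('x \<Rightarrow> 'y \<Rightarrow> real) \<Rightarrow> bool" where
  "bounded_score X Y a b h \<longleftrightarrow>
     (\<lambda>(x, y). h x y) \<in> borel_measurable (X \<Otimes>\<^sub>M count_space Y) \<and>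
     (\<forall>x\<in>space X. \<forall>y\<in>Y. h x y \<in> {a..b})"

text \<open>A smoothing scheme is a family of random points \<open>\<xi> x\<close> of \<open>X\<close> on an auxiliary probability
  space \<open>N\<close>, which carries only the smoothing noise; hence the smooth score and the CDF-based
  bound are deterministic functions of \<open>(x, y)\<close>.\<close>

definition smoothing_scheme :: "'x measure \<Rightarrow> 'v measure \<Rightarrow> ('x \<Rightarrow> 'v \<Rightarrow> 'x) \<Rightarrow> bool" where
  "smoothing_scheme X N \<xi> \<longleftrightarrow> prob_space N \<and> (\<forall>x\<in>space X. \<xi> x \<in> measurable N X)"

definition smooth_score ::
  "'v measure \<Rightarrow> ('x \<Rightarrow> 'v \<Rightarrow> 'x) \<Rightarrow> ('x \<Rightarrow> 'y \<Rightarrow> real) \<Rightarrow> 'x \<Rightarrow> 'y \<Rightarrow> real" where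
  "smooth_score N \<xi> s x y = (\<integral>v. s (\<xi> x v) y \<partial>N)"

definition score_cdf ::
  "'v measure \<Rightarrow> ('x \<Rightarrow> 'v \<Rightarrow> 'x) \<Rightarrow> ('x \<Rightarrow> 'y \<Rightarrow> real) \<Rightarrow> 'x \<Rightarrow> 'y \<Rightarrow> real \<Rightarrow> real" where
  "score_cdf N \<xi> s x y t = measure N {v \<in> space N. s (\<xi> x v) y \<le> t}"

text \<open>The grid \<open>a = \<beta> 1 < \<beta> 2 \<le> \<dots> \<le> \<beta> (m - 1) < \<beta> m = b\<close>.\<close>

definition cdf_grid :: "real \<Rightarrow> real \<Rightarrow> nat \<Rightarrow> (nat \<Rightarrow> real) \<Rightarrow> bool" where
  "cdf_grid a b m \<beta> \<longleftrightarrow>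
     2 \<le> m \<and> \<beta> 1 = a \<and> \<beta> m = b \<and> \<beta> 1 < \<beta> 2 \<and> \<beta> (m - 1) < \<beta> m \<and>
     (\<forall>j. 2 \<le> j \<and> j + 1 \<le> m - 1 \<longrightarrow> \<beta> j \<le> \<beta> (j + 1))"

text \<open>The infimum is taken in \<^typ>\<open>ereal\<close>, so that it is \<open>\<infinity>\<close> where \<open>B x\<close> is empty; when
  \<open>B x\<close> is nonempty it lies in \<open>[a, b]\<close>, the score \<open>s\<close> itself being feasible.\<close>

definition cdf_lower_bound ::
  "'x measure \<Rightarrow> 'y set \<Rightarrow> 'v measure \<Rightarrow> ('x \<Rightarrow> 'v \<Rightarrow> 'x) \<Rightarrow> ('x \<Rightarrow> 'x set) \<Rightarrow>
   real \<Rightarrow> real \<Rightarrow> nat \<Rightarrow> (nat \<Rightarrow> real) \<Rightarrow> ('x \<Rightarrow> 'y \<Rightarrow> real) \<Rightarrow> 'x \<Rightarrow> 'y \<Rightarrow> ereal" where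
  "cdf_lower_bound X Y N \<xi> B a b m \<beta> s x y =
     Inf {ereal (\<integral>v. h (\<xi> x' v) y \<partial>N) | x' h.
            x' \<in> B x \<and> bounded_score X Y a b h \<and>
            (\<forall>j\<in>{1..m}. score_cdf N \<xi> h x y (\<beta> j) = score_cdf N \<xi> s x y (\<beta> j))}"

definition Quant :: "real \<Rightarrow> real multiset \<Rightarrow> ereal" where
  "Quant \<tau> A =
     (let k = nat \<lfloor>\<tau> * (real (size A) + 1)\<rfloor>
      in if k = 0 then -\<infinity> else ereal (sorted_list_of_multiset A ! (k - 1)))"

definition prediction_set :: "'y set \<Rightarrow> ('y \<Rightarrow> real) \<Rightarrow> ereal \<Rightarrow> 'y set" where
  "prediction_set Y f q = {y \<in> Y. q \<le> ereal (f y)}"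

end

theory Submission
  imports Defs
begin

text \<open>Call \<open>j\<close> low if at most \<open>k\<close> indices \<open>i \<le> n + 1\<close> have \<open>S i \<le> S j\<close>, where \<open>S i\<close> is the exact bound
  at the \<open>i\<close>-th clean pair. There are never more than \<open>k\<close> low indices, and by exchangeability all
  indices are equally likely to be low, so \<open>n + 1\<close> is low with probability at most \<open>k / (n + 1)\<close>.
  For \<open>k = \<lfloor>(\<alpha> - \<eta>) (n + 1)\<rfloor>\<close> this is at most \<open>\<alpha> - \<eta>\<close>. If \<open>n + 1\<close> is not low and all estimated
  bounds are valid, at least \<open>k\<close> of the calibration values lie below the estimated test score,
  because \<open>s\<close> is itself feasible in the infimum defining \<open>S (n + 1)\<close>; invalid estimates cost at
  most \<open>\<eta> / 2 + \<eta> / 2\<close> by the union bound.\<close>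

section \<open>Order statistics and quantiles\<close>

text \<open>In a sorted list the entries that are at most \<open>t\<close> form a prefix, and the
  zero-based position \<open>k\<close> falls into it exactly when the prefix is longer than
  \<open>k\<close>.\<close>

lemma sorted_nth_le_iff_length_filter:
  fixes t :: "'a::linorder"
  assumes "sorted xs" "k < length xs"
  shows "xs ! k \<le> t \<longleftrightarrow> k < length (filter (\<lambda>z. z \<le> t) xs)"
  using assms
proof (induction xs arbitrary: k)
  case Nil
  then show ?case by simp
next
  case (Cons z zs)
  have none: "filter (\<lambda>w. w \<le> t) zs = []" if "\<not> z \<le> t"
    using Cons.prems that by (auto simp: filter_empty_conv)
  show ?case
  proof (cases k)
    case 0
    with none show ?thesis by auto
  next
    case (Suc l)
    have le: "z \<le> zs ! l" using Cons.prems Suc by auto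
    have IH: "zs ! l \<le> t \<longleftrightarrow> l < length (filter (\<lambda>z. z \<le> t) zs)"
      using Cons.IH[of l] Cons.prems Suc by auto
    show ?thesis
      using IH Suc le none order_trans[of z "zs ! l" t] by auto
  qed
qed

text \<open>This turns a comparison with a quantile into a count. The assumption keeps the list
  index in range; at rank 0 the quantile is minus infinity and both sides hold.\<close>

lemma Quant_le_iff:
  assumes "nat \<lfloor>\<tau> * (real (size A) + 1)\<rfloor> \<le> size A"
  shows "Quant \<tau> A \<le> ereal t \<longleftrightarrow>
    nat \<lfloor>\<tau> * (real (size A) + 1)\<rfloor> \<le> size (filter_mset (\<lambda>z. z \<le> t) A)"
proof (cases "nat \<lfloor>\<tau> * (real (size A) + 1)\<rfloor> = 0")
  case True
  then show ?thesis by (simp add: Quant_def)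
next
  case False
  define k where "k = nat \<lfloor>\<tau> * (real (size A) + 1)\<rfloor>"
  let ?xs = "sorted_list_of_multiset A"
  have len: "length ?xs = size A" by (metis mset_sorted_list_of_multiset size_mset)
  have "size (filter_mset (\<lambda>z. z \<le> t) A) = length (filter (\<lambda>z. z \<le> t) ?xs)"
    by (metis mset_filter mset_sorted_list_of_multiset size_mset)
  \<comment> \<open>The \<open>k\<close>-th smallest element has list index \<open>k - 1\<close>; as
    \<open>k\<close> is positive, the strict inequality for \<open>k - 1\<close> is the weak one for
    \<open>k\<close>.\<close>
  moreover have "?xs ! (k - 1) \<le> t \<longleftrightarrow> k - 1 < length (filter (\<lambda>z. z \<le> t) ?xs)"
    using assms False len unfolding k_def[symmetric]
    by (intro sorted_nth_le_iff_length_filter) auto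
  ultimately show ?thesis
    using False unfolding Quant_def Let_def k_def[symmetric] by auto
qed

lemma size_filter_image_mset_set:
  assumes "finite I"
  shows "size (filter_mset P (image_mset f (mset_set I))) = card {i \<in> I. P (f i)}"
  using assms by (simp add: filter_mset_image_mset filter_mset_mset_set)

section \<open>Ranks under exchangeability\<close>

text \<open>Among the low indices take one with the largest value: every low index is counted in its
  rank, which is at most \<open>k\<close>. Ties do no harm.\<close>

lemma card_low_rank_le:
  fixes f :: "'i \<Rightarrow> 'a::linorder"
  assumes "finite I"
  shows "card {j \<in> I. card {i \<in> I. f i \<le> f j} \<le> k} \<le> k"
proof (cases "{j \<in> I. card {i \<in> I. f i \<le> f j} \<le> k} = {}")
  case True
  then show ?thesis by (metis card.empty zero_le)
next
  case False
  let ?J = "{j \<in> I. card {i \<in> I. f i \<le> f j} \<le> k}"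
  have fin: "finite (f ` ?J)" "f ` ?J \<noteq> {}" using assms False by auto
  obtain j where j: "j \<in> ?J" "f j = Max (f ` ?J)" using Max_in[OF fin] by auto
  have "?J \<subseteq> {i \<in> I. f i \<le> f j}" using j(2) fin by auto
  then have "card ?J \<le> card {i \<in> I. f i \<le> f j}" using assms by (intro card_mono) auto
  also have "\<dots> \<le> k" using j(1) by simp
  finally show ?thesis .
qed

lemma measurable_card_Collect:
  assumes "finite I" "\<And>i. i \<in> I \<Longrightarrow> Measurable.pred M (P i)"
  shows "(\<lambda>\<omega>. card {i \<in> I. P i \<omega>}) \<in> measurable M (count_space UNIV)"
proof -
  have "(\<lambda>\<omega>. \<Sum>i\<in>I. if P i \<omega> then 1 else 0 :: nat) \<in> measurable M (count_space UNIV)"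
    using assms(2) by measurable
  moreover have "card {i \<in> I. P i \<omega>} = (\<Sum>i\<in>I. if P i \<omega> then 1 else 0)" for \<omega>
    using assms(1) by (simp add: sum.If_cases Int_def)
  ultimately show ?thesis by simp
qed

text \<open>The events that \<open>l\<close> is low have equal probability for all \<open>l\<close>,
  and at each outcome at most \<open>k\<close> of them occur, so integrating the number of low
  indices gives the bound. The values of \<open>f\<close> lie in a general linear order so that
  \<open>ereal\<close> is covered, where the CDF bound lives.\<close>

lemma exchangeable_low_rank_le:
  fixes f :: "'z \<Rightarrow> 'a::{linorder_topology, second_countable_topology}"
  assumes M: "prob_space M" and I: "finite I" "j \<in> I"
    and ex: "exchangeable M S I Z" and f [measurable]: "f \<in> borel_measurable S"
  shows "measure M {\<omega> \<in> space M. card {i \<in> I. f (Z i \<omega>) \<le> f (Z j \<omega>)} \<le> k} \<le> k / card I"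
proof -
  interpret prob_space M by fact
  define E where "E l = {\<omega> \<in> space M. card {i \<in> I. f (Z i \<omega>) \<le> f (Z l \<omega>)} \<le> k}" for l
  have Z [measurable]: "Z i \<in> measurable M S" if "i \<in> I" for i
    using ex that by (auto simp: exchangeable_def)
  have cardm [measurable]:
    "(\<lambda>\<omega>. card {i \<in> I. f (Z i \<omega>) \<le> f (Z l \<omega>)}) \<in> measurable M (count_space UNIV)" if "l \<in> I" for l
    using that I by (intro measurable_card_Collect) measurable
  have E [measurable]: "E l \<in> sets M" if "l \<in> I" for l
    using that unfolding E_def by measurable
  let ?P = "\<Pi>\<^sub>M i\<in>I. S"
  \<comment> \<open>The event \<open>E j\<close> is restated as a set of value vectors, because
    exchangeability compares laws on the product space.\<close>
  define A where "A = {z \<in> space ?P. card {i \<in> I. f (z i) \<le> f (z j)} \<le> k}"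
  have f_component: "(\<lambda>z. f (z i)) \<in> borel_measurable ?P" if "i \<in> I" for i
    by (rule measurable_compose[OF _ f]) (rule measurable_component_singleton[OF that])
  have cardA [measurable]:
    "(\<lambda>z. card {i \<in> I. f (z i) \<le> f (z j)}) \<in> measurable ?P (count_space UNIV)"
    using I
    by (intro measurable_card_Collect) (auto simp: pred_def intro!: borel_measurable_le f_component)
  have A: "A \<in> sets ?P" unfolding A_def by measurable
  have same: "measure M (E l) = measure M (E j)" if l: "l \<in> I" for l
  proof -
    \<comment> \<open>Swapping \<open>l\<close> and \<open>j\<close> puts \<open>Z l\<close> into
      coordinate \<open>j\<close>, so the law of the swapped vector gives \<open>A\<close> the
      probability of \<open>E l\<close>.\<close>
    define \<pi> where "\<pi> = Transposition.transpose l j"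
    have \<pi>: "\<pi> permutes I" unfolding \<pi>_def using l I(2) by (rule permutes_swap_id)
    have perm: "measure (distr M ?P (\<lambda>\<omega>. \<lambda>i\<in>I. Z (p i) \<omega>)) A = measure M (E (p j))"
      if p: "p permutes I" for p
    proof -
      have pI: "p i \<in> I" if "i \<in> I" for i using p that by (simp add: permutes_in_image)
      have m: "(\<lambda>\<omega>. \<lambda>i\<in>I. Z (p i) \<omega>) \<in> measurable M ?P"
        using pI by (intro measurable_restrict Z) auto
      \<comment> \<open>Permuting the coordinates only reindexes the set being counted, so a rank
        depends on the permutation only through the value compared against.\<close>
      have c: "card {i \<in> I. f (Z (p i) \<omega>) \<le> t} = card {i \<in> I. f (Z i \<omega>) \<le> t}" for \<omega> t
      proof -
        have "bij_betw p {i \<in> I. f (Z (p i) \<omega>) \<le> t} {i \<in> I. f (Z i \<omega>) \<le> t}"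
          unfolding bij_betw_def
        proof
          show "inj_on p {i \<in> I. f (Z (p i) \<omega>) \<le> t}"
            using permutes_inj[OF p] by (auto intro: inj_on_subset)
          show "p ` {i \<in> I. f (Z (p i) \<omega>) \<le> t} = {i \<in> I. f (Z i \<omega>) \<le> t}"
            using permutes_image[OF p] by auto
        qed
        then show ?thesis by (rule bij_betw_same_card)
      qed
      have "(\<lambda>\<omega>. \<lambda>i\<in>I. Z (p i) \<omega>) -` A \<inter> space M = E (p j)"
      proof -
        have "(\<lambda>i\<in>I. Z (p i) \<omega>) \<in> A \<longleftrightarrow> \<omega> \<in> E (p j)" if w: "\<omega> \<in> space M" for \<omega>
        proof -
          have "{i \<in> I. f ((\<lambda>i\<in>I. Z (p i) \<omega>) i) \<le> f ((\<lambda>i\<in>I. Z (p i) \<omega>) j)}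
              = {i \<in> I. f (Z (p i) \<omega>) \<le> f (Z (p j) \<omega>)}"
            using I by auto
          then show ?thesis
            using measurable_space[OF m w] w c[of \<omega> "f (Z (p j) \<omega>)"]
            unfolding A_def E_def by simp
        qed
        moreover have "E (p j) \<subseteq> space M" by (auto simp: E_def)
        ultimately show ?thesis by auto
      qed
      then show ?thesis by (simp add: measure_distr[OF m A])
    qed
    have "distr M ?P (\<lambda>\<omega>. \<lambda>i\<in>I. Z (\<pi> i) \<omega>) = distr M ?P (\<lambda>\<omega>. \<lambda>i\<in>I. Z i \<omega>)"
      using ex \<pi> by (auto simp: exchangeable_def)
    then show ?thesis
      using perm[OF \<pi>] perm[OF permutes_id] by (simp add: \<pi>_def)
  qed
  \<comment> \<open>Double counting: both sides are the expected number of low indices.\<close>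
  have "card I * measure M (E j) = (\<Sum>l\<in>I. measure M (E l))"
    using same by simp
  also have "\<dots> = (\<Sum>l\<in>I. \<integral>\<omega>. indicator (E l) \<omega> \<partial>M)"
    by (intro sum.cong refl) (use E in \<open>simp add: E_def\<close>)
  also have "\<dots> = (\<integral>\<omega>. (\<Sum>l\<in>I. indicator (E l) \<omega>) \<partial>M)"
    by (rule Bochner_Integration.integral_sum[symmetric])
      (use E in \<open>auto intro!: integrable_real_indicator simp: emeasure_eq_measure\<close>)
  also have "\<dots> \<le> (\<integral>\<omega>. real k \<partial>M)"
  proof (rule integral_mono)
    show "integrable M (\<lambda>\<omega>. \<Sum>l\<in>I. indicator (E l) \<omega> :: real)"
      using E by (auto intro!: Bochner_Integration.integrable_sum integrable_real_indicator
          simp: emeasure_eq_measure)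
    show "(\<Sum>l\<in>I. indicator (E l) \<omega>) \<le> real k" if "\<omega> \<in> space M" for \<omega>
    proof -
      have "(\<Sum>l\<in>I. indicator (E l) \<omega>)
          = real (card {l \<in> I. card {i \<in> I. f (Z i \<omega>) \<le> f (Z l \<omega>)} \<le> k})"
        using I(1) that by (simp add: E_def indicator_def sum.If_cases Int_def)
      then show ?thesis using card_low_rank_le[OF I(1), of "\<lambda>i. f (Z i \<omega>)" k] by simp
    qed
  qed simp
  also have "\<dots> = k" by (simp add: prob_space)
  finally have "card I * measure M (E j) \<le> k" .
  moreover have "card I > 0" using I by (auto simp: card_gt_0_iff)
  ultimately show ?thesis
    unfolding E_def by (simp add: pos_le_divide_eq mult.commute)
qed

section \<open>From the CDF bound to coverage\<close>

text \<open>The pair of \<open>x'\<close> and \<open>h = s\<close> is admissible in the infimum,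
  since \<open>s\<close> matches its own CDF values on the grid.\<close>

lemma cdf_lower_bound_le_smooth_score:
  assumes "bounded_score X Y a b s" "x' \<in> B x"
  shows "cdf_lower_bound X Y N \<xi> B a b m \<beta> s x y \<le> ereal (smooth_score N \<xi> s x' y)"
  unfolding cdf_lower_bound_def smooth_score_def
  using assms by (intro Inf_lower) blast

theorem proposition6p1:
  fixes M :: "'w measure" and X :: "'x measure" and Y :: "'y set"
    and N :: "'v measure" and \<xi> :: "'x \<Rightarrow> 'v \<Rightarrow> 'x" and B :: "'x \<Rightarrow> 'x set"
    and s :: "'x \<Rightarrow> 'y \<Rightarrow> real" and a b :: real and m :: nat and \<beta> :: "nat \<Rightarrow> real"
    and n :: nat and x :: "nat \<Rightarrow> 'w \<Rightarrow> 'x" and y :: "nat \<Rightarrow> 'w \<Rightarrow> 'y"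
    and x_tilde :: "'w \<Rightarrow> 'x"
    and s_cdf_plus :: "nat \<Rightarrow> 'w \<Rightarrow> real" and s_hat_plus :: "'y \<Rightarrow> 'w \<Rightarrow> real"
    and \<alpha> \<eta> :: real
  assumes "prob_space M"
    and "finite Y"
    and "\<forall>u\<in>space X. B u \<subseteq> space X"
    and "bounded_score X Y a b s"
    and "smoothing_scheme X N \<xi>"
    and "cdf_grid a b m \<beta>"
    and "(\<lambda>(u, c). cdf_lower_bound X Y N \<xi> B a b m \<beta> s u c)
           \<in> borel_measurable (X \<Otimes>\<^sub>M count_space Y)"
    and "exchangeable M (X \<Otimes>\<^sub>M count_space Y) {1..n + 1} (\<lambda>i \<omega>. (x i \<omega>, y i \<omega>))"
    and "x_tilde \<in> measurable M X"
    and "AE \<omega> in M. x_tilde \<omega> \<in> B (x (n + 1) \<omega>)"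
    and "0 < \<eta>" and "\<eta> < \<alpha>" and "\<alpha> < 1"
    and "\<forall>i\<in>{1..n}. s_cdf_plus i \<in> borel_measurable M"
    and "\<forall>i\<in>{1..n}.
           measure M {\<omega> \<in> space M. ereal (s_cdf_plus i \<omega>)
             \<le> cdf_lower_bound X Y N \<xi> B a b m \<beta> s (x i \<omega>) (y i \<omega>)}
           \<ge> 1 - \<eta> / (2 * real n)"
    and "\<forall>c\<in>Y. s_hat_plus c \<in> borel_measurable M"
    and "measure M {\<omega> \<in> space M. s_hat_plus (y (n + 1) \<omega>) \<omega>
             \<ge> smooth_score N \<xi> s (x_tilde \<omega>) (y (n + 1) \<omega>)}
           \<ge> 1 - \<eta> / (2 * real (card Y))"
  shows "measure M {\<omega> \<in> space M. y (n + 1) \<omega> \<in>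
             prediction_set Y (\<lambda>c. s_hat_plus c \<omega>)
               (Quant (\<alpha> - \<eta>) (image_mset (\<lambda>i. s_cdf_plus i \<omega>) (mset_set {1..n})))}
           \<ge> 1 - \<alpha>"
proof -
  interpret prob_space M by fact
  define k where "k = nat \<lfloor>(\<alpha> - \<eta>) * (real n + 1)\<rfloor>"
  define S where "S i \<omega> = cdf_lower_bound X Y N \<xi> B a b m \<beta> s (x i \<omega>) (y i \<omega>)" for i \<omega>
  \<comment> \<open>Since \<open>nat\<close> cuts off at 0, this uses that \<alpha> - \<eta> is
    positive.\<close>
  have k_real: "real k \<le> (\<alpha> - \<eta>) * (real n + 1)"
    using assms(12) by (simp add: k_def)
  have "(\<alpha> - \<eta>) * (real n + 1) < 1 * (real n + 1)"
    using assms(11,13) by (intro mult_strict_right_mono) auto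
  from le_less_trans[OF k_real this] have "real k < real n + 1" by simp
  then have "k \<le> n" by linarith
  have Z: "(\<lambda>\<omega>. (x i \<omega>, y i \<omega>)) \<in> measurable M (X \<Otimes>\<^sub>M count_space Y)" if "i \<in> {1..n+1}" for i
    using assms(8) that by (auto simp: exchangeable_def)
  have S [measurable]: "S i \<in> borel_measurable M" if "i \<in> {1..n+1}" for i
    using measurable_compose[OF Z[OF that] assms(7)] by (simp add: S_def[abs_def])
  have [measurable]: "y (n + 1) \<in> measurable M (count_space Y)"
    using measurable_compose[OF Z measurable_snd, of "n + 1"] by simp
  have yY: "y (n + 1) \<omega> \<in> Y" if "\<omega> \<in> space M" for \<omega>
    using measurable_space[OF \<open>y (n + 1) \<in> _\<close> that] by simp
  \<comment> \<open>A probability space has an outcome, and the test label there is an element of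
    \<open>Y\<close>.\<close>
  have "Y \<noteq> {}" using yY not_empty by auto
  then have cardY: "card Y \<ge> 1" using assms(2) by (simp add: Suc_le_eq card_gt_0_iff)

  define T where "T \<omega> = s_hat_plus (y (n + 1) \<omega>) \<omega>" for \<omega>
  have T [measurable]: "T \<in> borel_measurable M"
  proof -
    have "{\<omega> \<in> space M. y (n + 1) \<omega> = c} \<in> sets M" if "c \<in> Y" for c
      using that by measurable
    \<comment> \<open>Measurability is given for each fixed label; as \<open>Y\<close> is finite,
      evaluation at the random label is a finite sum over the possible labels.\<close>
    then have "(\<lambda>\<omega>. \<Sum>c\<in>Y. if y (n + 1) \<omega> = c then s_hat_plus c \<omega> else 0) \<in> borel_measurable M"
      using assms(16) by (intro borel_measurable_sum measurable_If) auto
    moreover have "(\<Sum>c\<in>Y. if y (n + 1) \<omega> = c then s_hat_plus c \<omega> else 0) = T \<omega>"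
      if "\<omega> \<in> space M" for \<omega>
      using yY[OF that] assms(2) by (simp add: T_def)
    ultimately show ?thesis by (simp cong: measurable_cong)
  qed
  have sp [measurable]: "s_cdf_plus i \<in> borel_measurable M" if "i \<in> {1..n}" for i
    using assms(14) that by auto

  \<comment> \<open>This is the coverage event in counting form: the quantile is at most
    \<open>T\<close> exactly when at least \<open>k\<close> calibration values are.\<close>
  define G where "G = {\<omega> \<in> space M. k \<le> card {i \<in> {1..n}. s_cdf_plus i \<omega> \<le> T \<omega>}}"
  have G_eq: "{\<omega> \<in> space M. y (n + 1) \<omega> \<in> prediction_set Y (\<lambda>c. s_hat_plus c \<omega>)
      (Quant (\<alpha> - \<eta>) (image_mset (\<lambda>i. s_cdf_plus i \<omega>) (mset_set {1..n})))} = G"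
    using yY \<open>k \<le> n\<close>
    by (auto simp: G_def prediction_set_def Quant_le_iff size_filter_image_mset_set T_def k_def)
  have "(\<lambda>\<omega>. card {i \<in> {1..n}. s_cdf_plus i \<omega> \<le> T \<omega>}) \<in> measurable M (count_space UNIV)"
    by (intro measurable_card_Collect) measurable
  then have G [measurable]: "G \<in> sets M" unfolding G_def by measurable

  define L where "L = {\<omega> \<in> space M. card {i \<in> {1..n+1}. S i \<omega> \<le> S (n + 1) \<omega>} \<le> k}"
  have "(\<lambda>\<omega>. card {i \<in> {1..n+1}. S i \<omega> \<le> S (n + 1) \<omega>}) \<in> measurable M (count_space UNIV)"
    by (intro measurable_card_Collect) measurable
  then have L [measurable]: "L \<in> sets M" unfolding L_def by measurable
  have "prob L \<le> k / card {1..n+1}"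
    using exchangeable_low_rank_le[OF assms(1) _ _ assms(8) assms(7), of "n + 1" k]
    by (simp add: L_def S_def)
  \<comment> \<open>The factor \<open>n + 1\<close> in the quantile convention cancels against the
    number of exchangeable pairs.\<close>
  also have "\<dots> \<le> \<alpha> - \<eta>" using k_real by (simp add: pos_divide_le_eq add.commute)
  finally have PL: "prob L \<le> \<alpha> - \<eta>" .

  define V where "V i = {\<omega> \<in> space M. ereal (s_cdf_plus i \<omega>) \<le> S i \<omega>}" for i
  have V [measurable]: "V i \<in> sets M" if "i \<in> {1..n}" for i
    unfolding V_def using that by (intro borel_measurable_le borel_measurable_ereal sp S) auto
  have VU [measurable]: "(\<Union>i\<in>{1..n}. space M - V i) \<in> sets M"
    using V by (intro sets.finite_UN) auto
  have PV: "prob (\<Union>i\<in>{1..n}. space M - V i) \<le> \<eta> / 2"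
  proof -
    have "prob (\<Union>i\<in>{1..n}. space M - V i) \<le> (\<Sum>i\<in>{1..n}. prob (space M - V i))"
      by (intro finite_measure_subadditive_finite) auto
    also have "\<dots> \<le> (\<Sum>i\<in>{1..n}. \<eta> / (2 * real n))"
      using assms(15) by (intro sum_mono) (force simp: prob_compl V_def[symmetric] S_def[symmetric])
    \<comment> \<open>For \<open>n = 0\<close> the sum is empty; otherwise the factor
      \<open>n\<close> cancels.\<close>
    also have "\<dots> \<le> \<eta> / 2" using assms(11) by simp
    finally show ?thesis .
  qed

  define W where "W = {\<omega> \<in> space M. T \<omega> \<ge> smooth_score N \<xi> s (x_tilde \<omega>) (y (n + 1) \<omega>)}"
  have "\<eta> / (2 * real (card Y)) \<le> \<eta> / 2"
    using assms(11) cardY by (intro divide_left_mono) auto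
  then have PW: "1 - \<eta> / 2 \<le> prob W"
    using assms(17) unfolding W_def T_def by linarith
  \<comment> \<open>Joint measurability of \<open>\<xi>\<close> is not assumed, but a non-measurable \<open>W\<close> would have measure 0.\<close>
  have W [measurable]: "W \<in> sets M"
    using PW assms(11-13) measure_notin_sets[of W M] by force

  \<comment> \<open>Coverage can fail only on one of three bad events: a low test rank, an invalid
    calibration bound, or an invalid test score. This holds up to a null set because the
    perturbation is admissible almost surely.\<close>
  have AE: "AE \<omega> in M. \<omega> \<in> G \<union> (L \<union> (\<Union>i\<in>{1..n}. space M - V i) \<union> (space M - W))"
    using assms(10) AE_space
  proof eventually_elim
    case (elim \<omega>)
    have "\<omega> \<in> G" if "\<omega> \<notin> L" "\<forall>i\<in>{1..n}. \<omega> \<in> V i" "\<omega> \<in> W"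
    proof -
      let ?R = "{i \<in> {1..n}. S i \<omega> \<le> S (n + 1) \<omega>}"
      \<comment> \<open>The index \<open>n + 1\<close> always counts itself, so more than
        \<open>k\<close> indices among \<open>n + 1\<close> leave at least \<open>k\<close> among
        the calibration indices.\<close>
      have "{i \<in> {1..n+1}. S i \<omega> \<le> S (n + 1) \<omega>} = insert (n + 1) ?R"
        by (auto simp: le_Suc_eq)
      then have "k \<le> card ?R" using that(1) elim(2) by (simp add: L_def)
      also have "\<dots> \<le> card {i \<in> {1..n}. s_cdf_plus i \<omega> \<le> T \<omega>}"
      proof (intro card_mono subsetI)
        fix i assume i: "i \<in> ?R"
        then have "ereal (s_cdf_plus i \<omega>) \<le> S i \<omega>" using that(2) by (auto simp: V_def)
        also have "\<dots> \<le> S (n + 1) \<omega>" using i by simp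
        also have "\<dots> \<le> ereal (smooth_score N \<xi> s (x_tilde \<omega>) (y (n + 1) \<omega>))"
          unfolding S_def using assms(4) elim(1) by (rule cdf_lower_bound_le_smooth_score)
        also have "\<dots> \<le> ereal (T \<omega>)" using that(3) by (simp add: W_def)
        finally show "i \<in> {i \<in> {1..n}. s_cdf_plus i \<omega> \<le> T \<omega>}" using i by simp
      qed simp
      finally show ?thesis using elim(2) by (simp add: G_def)
    qed
    with elim(2) show ?case by auto
  qed
  \<comment> \<open>The union bound charges \<alpha> - \<eta> to the rank and \<eta> / 2 to each
    kind of invalid estimate, \<alpha> in total.\<close>
  have "1 = prob (G \<union> (L \<union> (\<Union>i\<in>{1..n}. space M - V i) \<union> (space M - W)))"
    using prob_eq_1[THEN iffD2, OF _ AE] VU by simp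
  also have "\<dots> \<le> prob G + (prob L + prob (\<Union>i\<in>{1..n}. space M - V i) + prob (space M - W))"
    by (intro order_trans[OF measure_Un_le] add_mono order_refl) (use VU in auto)
  also have "\<dots> \<le> prob G + (\<alpha> - \<eta> + \<eta> / 2 + \<eta> / 2)"
    using PL PV PW by (simp add: prob_compl)
  finally show ?thesis unfolding G_eq by simp
qed

end
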